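(* Let $f_a(\ddot q,\dot q,q,t)$, $a=1,\dots,n$, be smooth functions, and let $$r_{ab}=\frac{\partial f_a}{\partial q^b}-\frac{\partial f_b}{\partial q^a}+\frac12\frac{d}{dt}\left(\frac{\partial f_b}{\partial \dot q^a}-\frac{\partial f_a}{\partial \dot q^b}\right),\qquad s_{ab}=\frac12\left(\frac{\partial f_a}{\partial \dot q^b}+\frac{\partial f_b}{\partial \dot q^a}\right)-\frac{d}{dt}\left(\frac{\partial f_b}{\partial \ddot q^a}\right).$$ Suppose that $r_{ab}$ and $s_{ab}$ are of first order for all $a,b$, and that for all $a,b,c$ $$\frac{\partial f_a}{\partial \ddot q^b}=\frac{\partial f_b}{\partial \ddot q^a},\qquad \frac{\partial r_{ab}}{\partial \dot q^c}=\frac{\partial s_{ac}}{\partial q^b}-\frac{\partial s_{bc}}{\partial q^a}.$$ Then for all $a,b,c$ $$\frac{\partial s_{ab}}{\partial \dot q^c}=\frac{\partial s_{ac}}{\partial \dot q^b}\qquad\text{and}\qquad \frac{\partial r_{ab}}{\partial q^c}+\frac{\partial r_{bc}}{\partial q^a}+\frac{\partial r_{ca}}{\partial q^b}=0.$$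
   Context: Indices $a,b,c$ run over $1,\dots,n$ and repeated indices are summed. The variables $q=(q^a)$ (generalized coordinates), $\dot q=(\dot q^a)$, $\ddot q=(\ddot q^a)$, $\dddot q=(\dddot q^a)$ and $t$ are independent (jet) coordinates; $q$ ranges over an open set $U\subseteq\mathbb{R}^n$, $t$ over an open interval $I\subseteq\mathbb{R}$, and $\dot q,\ddot q,\dddot q$ each over all of $\mathbb{R}^n$. All functions are smooth ($C^\infty$). The total time derivative is $$\frac{d}{dt}=\frac{\partial}{\partial t}+\dot q^c\frac{\partial}{\partial q^c}+\ddot q^c\frac{\partial}{\partial \dot q^c}+\dddot q^c\frac{\partial}{\partial \ddot q^c},$$ so that for $f_a$ depending on $(\ddot q,\dot q,q,t)$ the functions $r_{ab}$, $s_{ab}$ a priori depend on $(\dddot q,\ddot q,\dot q,q,t)$. A function is said to be of first order if it depends only on $(\dot q,q,t)$, i.e. is independent of $\ddot q$ and $\dddot q$. *)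

theory Defs
  imports "HOL-Analysis.Analysis"
begin

text \<open>On an open set \<open>S\<close>, \<open>Ck_on k g S\<close> is the usual notion of class \<open>C\<^sup>k\<close>: directional derivatives
  along all fixed vectors, up to order \<open>k\<close>, exist (as Frechet derivatives below order \<open>k\<close>) and are
  continuous. It is only used on open sets.\<close>

primrec Ck_on :: "nat \<Rightarrow> ('a::real_normed_vector \<Rightarrow> real) \<Rightarrow> 'a set \<Rightarrow> bool" where
  "Ck_on 0 g S \<longleftrightarrow> continuous_on S g"
| "Ck_on (Suc k) g S \<longleftrightarrow>
     (\<forall>x\<in>S. g differentiable (at x)) \<and>
     (\<forall>v. Ck_on k (\<lambda>x. frechet_derivative g (at x) v) S)"

definition smooth_on :: "('a::real_normed_vector \<Rightarrow> real) \<Rightarrow> 'a set \<Rightarrow> bool" where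
  "smooth_on g S \<longleftrightarrow> (\<forall>k. Ck_on k g S)"

text \<open>Partial derivative along \<open>v\<close>; below, \<open>v\<close> is always a coordinate vector of a jet space.\<close>

definition pd :: "'a::real_normed_vector \<Rightarrow> ('a \<Rightarrow> real) \<Rightarrow> 'a \<Rightarrow> real" where
  "pd v g x = deriv (\<lambda>h. g (x + h *\<^sub>R v)) 0"

text \<open>A point of \<open>'n jet2\<close> is \<open>(q'', q', q, t)\<close> and a point of \<open>'n jet3\<close> is \<open>(q''', q'', q', q, t)\<close>
  (primes denoting time derivatives). Thus \<open>snd\<close> is the projection from \<open>'n jet3\<close> to \<open>'n jet2\<close>.\<close>

type_synonym 'n jet2 = "(real^'n) \<times> (real^'n) \<times> (real^'n) \<times> real"
type_synonym 'n jet3 = "(real^'n) \<times> 'n jet2"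

definition jet2_dom :: "(real^'n) set \<Rightarrow> real set \<Rightarrow> ('n::finite) jet2 set" where
  "jet2_dom U I = UNIV \<times> UNIV \<times> U \<times> I"

definition jet3_dom :: "(real^'n) set \<Rightarrow> real set \<Rightarrow> ('n::finite) jet3 set" where
  "jet3_dom U I = UNIV \<times> jet2_dom U I"

text \<open>Coordinate vectors of \<open>'n jet2\<close>; those of \<open>'n jet3\<close> are obtained as \<open>(0, e)\<close>.\<close>

definition e_qdd :: "'n \<Rightarrow> ('n::finite) jet2" where "e_qdd c = (axis c 1, 0, 0, 0)"
definition e_qd :: "'n \<Rightarrow> ('n::finite) jet2" where "e_qd c = (0, axis c 1, 0, 0)"
definition e_q :: "'n \<Rightarrow> ('n::finite) jet2" where "e_q c = (0, 0, axis c 1, 0)"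
definition e_t :: "('n::finite) jet2" where "e_t = (0, 0, 0, 1)"

definition total_deriv :: "(('n::finite) jet2 \<Rightarrow> real) \<Rightarrow> 'n jet3 \<Rightarrow> real" where
  "total_deriv g = (\<lambda>(qddd, qdd, qd, q, t).
      pd e_t g (qdd, qd, q, t)
    + (\<Sum>c\<in>UNIV. qd $ c * pd (e_q c) g (qdd, qd, q, t))
    + (\<Sum>c\<in>UNIV. qdd $ c * pd (e_qd c) g (qdd, qd, q, t))
    + (\<Sum>c\<in>UNIV. qddd $ c * pd (e_qdd c) g (qdd, qd, q, t)))"

definition r_fun :: "('n \<Rightarrow> 'n jet2 \<Rightarrow> real) \<Rightarrow> 'n \<Rightarrow> 'n \<Rightarrow> ('n::finite) jet3 \<Rightarrow> real" where
  "r_fun f a b z =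
     pd (e_q b) (f a) (snd z) - pd (e_q a) (f b) (snd z)
     + 1/2 * total_deriv (\<lambda>y. pd (e_qd a) (f b) y - pd (e_qd b) (f a) y) z"

definition s_fun :: "('n \<Rightarrow> 'n jet2 \<Rightarrow> real) \<Rightarrow> 'n \<Rightarrow> 'n \<Rightarrow> ('n::finite) jet3 \<Rightarrow> real" where
  "s_fun f a b z =
     1/2 * (pd (e_qd b) (f a) (snd z) + pd (e_qd a) (f b) (snd z))
     - total_deriv (pd (e_qdd a) (f b)) z"

definition first_order :: "(real^'n) set \<Rightarrow> real set \<Rightarrow> (('n::finite) jet3 \<Rightarrow> real) \<Rightarrow> bool" where
  "first_order U I g \<longleftrightarrow>
     (\<forall>qddd qddd' qdd qdd' qd. \<forall>q\<in>U. \<forall>t\<in>I. g (qddd, qdd, qd, q, t) = g (qddd', qdd', qd, q, t))"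

end

theory Submission
  imports Defs
begin

text \<open>Write \<open>X\<close>, \<open>V\<close>, \<open>Q\<close> for the derivatives along \<open>q''\<close>, \<open>q'\<close>, \<open>q\<close>, \<open>D\<close> for the total derivative,
  and \<open>W\<^sub>a\<^sub>b = V\<^sub>a f\<^sub>b - V\<^sub>b f\<^sub>a\<close>. The argument rests on the commutation rules \<open>X\<^sub>c D = D X\<^sub>c + V\<^sub>c\<close>,
  \<open>V\<^sub>c D = D V\<^sub>c + Q\<^sub>c\<close>, \<open>Q\<^sub>c D = D Q\<^sub>c\<close>, and on \<open>D g\<close> having \<open>X\<^sub>c g\<close> as derivative along the
  \<open>c\<close>-th component of \<open>q'''\<close>. Independence of \<open>r\<^sub>a\<^sub>b\<close> from \<open>q'''\<close> then says \<open>X\<^sub>c W\<^sub>a\<^sub>b = 0\<close>, and its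
  independence from \<open>q''\<close> says \<open>V\<^sub>c W\<^sub>a\<^sub>b = 2 (Q\<^sub>a X\<^sub>c f\<^sub>b - Q\<^sub>b X\<^sub>c f\<^sub>a)\<close>. Together these give the
  symmetry of \<open>V\<^sub>c s\<^sub>a\<^sub>b\<close> in \<open>b\<close> and \<open>c\<close>. The second identity also cancels all \<open>D\<close>-terms in the
  hypothesis on \<open>V\<^sub>c r\<^sub>a\<^sub>b\<close>, which becomes the vanishing of the cyclic sum of \<open>Q\<^sub>c W\<^sub>a\<^sub>b\<close>. Half of its
  total derivative is the cyclic sum of \<open>Q\<^sub>c r\<^sub>a\<^sub>b\<close>, whose remaining terms cancel by the symmetry of
  second derivatives.\<close>

section \<open>Derivatives along lines\<close>

lemma has_real_derivative_along_line:
  assumes "g differentiable (at (x + s *\<^sub>R v))"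
  shows "((\<lambda>h. g (x + h *\<^sub>R v)) has_real_derivative
          frechet_derivative g (at (x + s *\<^sub>R v)) v) (at s)"
proof -
  let ?D = "frechet_derivative g (at (x + s *\<^sub>R v))"
  have D: "(g has_derivative ?D) (at (x + s *\<^sub>R v))"
    using assms frechet_derivative_works by blast
  have "((\<lambda>h. x + h *\<^sub>R v) has_derivative (\<lambda>k. k *\<^sub>R v)) (at s)"
    by (auto intro!: derivative_eq_intros)
  then have "((\<lambda>h. g (x + h *\<^sub>R v)) has_derivative (\<lambda>k. ?D (k *\<^sub>R v))) (at s)"
    using D by (rule has_derivative_compose)
  moreover have "?D (k *\<^sub>R v) = ?D v * k" for k
    using linear_frechet_derivative[OF assms] by (simp add: linear_cmul mult.commute)
  ultimately show ?thesis
    by (simp add: has_field_derivative_def)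
qed

lemma pd_eq_frechet_derivative:
  assumes "g differentiable (at x)"
  shows "pd v g x = frechet_derivative g (at x) v"
  using has_real_derivative_along_line[of g x 0 v] assms
  by (simp add: pd_def DERIV_imp_deriv)

text \<open>The parameter \<open>s\<close> is arbitrary, not just 0, so that the mean value theorem
  can be applied along a whole segment.\<close>

lemma has_real_derivative_pd:
  assumes "g differentiable (at (x + s *\<^sub>R v))"
  shows "((\<lambda>h. g (x + h *\<^sub>R v)) has_real_derivative pd v g (x + s *\<^sub>R v)) (at s)"
  using has_real_derivative_along_line[OF assms] pd_eq_frechet_derivative[OF assms] by simp

lemma eventually_line_mem:
  fixes x v :: "'a::real_normed_vector"
  assumes "open S" "x \<in> S"
  shows "\<forall>\<^sub>F h in nhds 0. x + h *\<^sub>R v \<in> S"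
proof -
  have "((\<lambda>h. x + h *\<^sub>R v) \<longlongrightarrow> x + 0 *\<^sub>R v) (nhds 0)"
    by (intro tendsto_intros filterlim_ident)
  then show ?thesis
    using assms by (intro topological_tendstoD[where S = S]) auto
qed

text \<open>Openness keeps the line through \<open>x\<close> inside \<open>S\<close> for small
  parameters, so identities known only on \<open>S\<close> may be differentiated.\<close>

lemma pd_cong:
  assumes "open S" "x \<in> S" "\<And>y. y \<in> S \<Longrightarrow> g y = g' y"
  shows "pd v g x = pd v g' x"
  unfolding pd_def
  by (rule deriv_cong_ev)
     (auto intro: eventually_mono[OF eventually_line_mem[OF assms(1,2)]] assms(3))

lemma pd_zero_fun [simp]: "pd v (\<lambda>_. 0) x = 0"
  by (simp add: pd_def)

lemma pd_zero_direction [simp]: "pd 0 g = (\<lambda>_. 0)"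
  by (simp add: pd_def fun_eq_iff)

lemma pd_linear_combination:
  assumes "g differentiable (at x)" "g' differentiable (at x)"
  shows "pd v (\<lambda>y. \<alpha> * g y + \<beta> * g' y) x = \<alpha> * pd v g x + \<beta> * pd v g' x"
  unfolding pd_def[of v "\<lambda>y. \<alpha> * g y + \<beta> * g' y"]
  by (rule DERIV_imp_deriv)
     (use has_real_derivative_pd[of g x 0 v] has_real_derivative_pd[of g' x 0 v] assms
       in \<open>auto intro!: derivative_eq_intros\<close>)

section \<open>Smoothness and its closure properties\<close>

lemma Ck_on_cong:
  assumes "open S" "\<And>y. y \<in> S \<Longrightarrow> g y = g' y" "Ck_on k g S"
  shows "Ck_on k g' S"
  using assms(2,3)
proof (induction k arbitrary: g g')
  case 0
  then show ?case
    using continuous_on_cong[of S S g g'] by simp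
next
  case (Suc k)
  have diff: "g differentiable (at x)" if "x \<in> S" for x
    using Suc.prems(2) that by simp
  have eq: "frechet_derivative g (at x) = frechet_derivative g' (at x)" if "x \<in> S" for x
    using diff[OF that] assms(1) that Suc.prems(1)
    by (rule frechet_derivative_transform_within_open)
  have "g' differentiable (at x)" if "x \<in> S" for x
  proof -
    have "(g has_derivative frechet_derivative g (at x)) (at x)"
      using diff[OF that] by (rule frechet_derivative_works[THEN iffD1])
    then have "(g' has_derivative frechet_derivative g (at x)) (at x)"
      using assms(1) that Suc.prems(1) by (rule has_derivative_transform_within_open)
    then show ?thesis
      by (rule differentiableI)
  qed
  moreover have "Ck_on k (\<lambda>x. frechet_derivative g' (at x) v) S" for v
  proof (rule Suc.IH)
    show "Ck_on k (\<lambda>x. frechet_derivative g (at x) v) S"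
      using Suc.prems(2) by simp
  qed (simp add: eq)
  ultimately show ?case
    by simp
qed

lemma smooth_on_differentiable:
  assumes "smooth_on g S" "x \<in> S"
  shows "g differentiable (at x)"
proof -
  have "Ck_on (Suc 0) g S"
    using assms(1) unfolding smooth_on_def ..
  then show ?thesis
    using assms(2) by simp
qed

lemma smooth_on_continuous_on:
  assumes "smooth_on g S"
  shows "continuous_on S g"
proof -
  have "Ck_on 0 g S"
    using assms unfolding smooth_on_def ..
  then show ?thesis
    by simp
qed

text \<open>One order of differentiability is spent on the derivative. \<open>Ck_on_cong\<close> is
  needed because \<open>pd\<close> and the Frechet derivative are known to agree only on
  \<open>S\<close>.\<close>

lemma smooth_on_pd:
  assumes "open S" "smooth_on g S"
  shows "smooth_on (pd v g) S"
  unfolding smooth_on_def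
proof
  fix k
  have "Ck_on (Suc k) g S"
    using assms(2) unfolding smooth_on_def ..
  then have "Ck_on k (\<lambda>x. frechet_derivative g (at x) v) S"
    by simp
  then show "Ck_on k (pd v g) S"
    by (rule Ck_on_cong[OF assms(1), rotated])
       (simp add: pd_eq_frechet_derivative smooth_on_differentiable[OF assms(2)])
qed

lemma Ck_on_diff:
  assumes "open S" "Ck_on k g S" "Ck_on k g' S"
  shows "Ck_on k (\<lambda>x. g x - g' x) S"
  using assms(2,3)
proof (induction k arbitrary: g g')
  case 0
  then show ?case
    by (simp add: continuous_on_diff)
next
  case (Suc k)
  have diff: "g differentiable (at x)" "g' differentiable (at x)" if "x \<in> S" for x
    using Suc.prems that by simp_all
  have eq: "frechet_derivative g (at x) v - frechet_derivative g' (at x) v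
      = frechet_derivative (\<lambda>x. g x - g' x) (at x) v" if "x \<in> S" for x v
  proof -
    have "((\<lambda>x. g x - g' x) has_derivative
        (\<lambda>v. frechet_derivative g (at x) v - frechet_derivative g' (at x) v)) (at x)"
      by (rule has_derivative_diff; rule frechet_derivative_works[THEN iffD1]; rule diff[OF that])
    from frechet_derivative_at[OF this] show ?thesis
      by (rule fun_cong)
  qed
  have "Ck_on k (\<lambda>x. frechet_derivative (\<lambda>x. g x - g' x) (at x) v) S" for v
  proof (rule Ck_on_cong[OF assms(1)])
    show "Ck_on k (\<lambda>x. frechet_derivative g (at x) v - frechet_derivative g' (at x) v) S"
      by (rule Suc.IH) (use Suc.prems in simp_all)
  qed (rule eq)
  then show ?case
    using diff by (simp add: differentiable_diff)
qed

lemma smooth_on_diff: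
  assumes "open S" "smooth_on g S" "smooth_on g' S"
  shows "smooth_on (\<lambda>x. g x - g' x) S"
  using assms by (simp add: smooth_on_def Ck_on_diff)

section \<open>Symmetry of second derivatives\<close>

text \<open>Two applications of the mean value theorem, first along \<open>u\<close> and then along
  \<open>v\<close>. The left side is symmetric in \<open>u\<close> and \<open>v\<close>, which is
  what yields the symmetry of mixed derivatives.\<close>

lemma second_difference_mean_value:
  assumes "h > 0"
    and mem: "\<And>s t. \<lbrakk>0 \<le> s; s \<le> h; 0 \<le> t; t \<le> h\<rbrakk> \<Longrightarrow> x + s *\<^sub>R u + t *\<^sub>R v \<in> S"
    and g: "\<And>y. y \<in> S \<Longrightarrow> g differentiable (at y)"
    and g': "\<And>y. y \<in> S \<Longrightarrow> pd u g differentiable (at y)"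
  obtains s t where "0 < s" "s < h" "0 < t" "t < h"
    "g (x + h *\<^sub>R u + h *\<^sub>R v) - g (x + h *\<^sub>R u) - g (x + h *\<^sub>R v) + g x
      = h * h * pd v (pd u g) (x + s *\<^sub>R u + t *\<^sub>R v)"
proof -
  \<comment> \<open>The function of \<open>s\<close> is the increment of \<open>g\<close> across the
    step \<open>h\<close> along \<open>v\<close>.\<close>
  have "\<exists>s>0. s < h \<and>
      (g (x + h *\<^sub>R v + h *\<^sub>R u) - g (x + h *\<^sub>R u))
       - (g (x + h *\<^sub>R v + 0 *\<^sub>R u) - g (x + 0 *\<^sub>R u))
      = (h - 0) * (pd u g (x + h *\<^sub>R v + s *\<^sub>R u) - pd u g (x + s *\<^sub>R u))"
  proof (rule MVT2[OF \<open>h > 0\<close>])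
    fix s assume "0 \<le> s" "s \<le> h"
    then have "x + s *\<^sub>R u + h *\<^sub>R v \<in> S" "x + s *\<^sub>R u + 0 *\<^sub>R v \<in> S"
      using mem[of s h] mem[of s 0] \<open>h > 0\<close> by auto
    then have "g differentiable (at (x + h *\<^sub>R v + s *\<^sub>R u))" "g differentiable (at (x + s *\<^sub>R u))"
      using g by (simp_all add: add_ac)
    then show "((\<lambda>s. g (x + h *\<^sub>R v + s *\<^sub>R u) - g (x + s *\<^sub>R u)) has_real_derivative
        pd u g (x + h *\<^sub>R v + s *\<^sub>R u) - pd u g (x + s *\<^sub>R u)) (at s)"
      by (intro DERIV_diff has_real_derivative_pd)
  qed
  then obtain s where s: "0 < s" "s < h" and
    first: "(g (x + h *\<^sub>R v + h *\<^sub>R u) - g (x + h *\<^sub>R u)) - (g (x + h *\<^sub>R v) - g x)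
      = h * (pd u g (x + h *\<^sub>R v + s *\<^sub>R u) - pd u g (x + s *\<^sub>R u))"
    by auto
  have "\<exists>t>0. t < h \<and> pd u g (x + s *\<^sub>R u + h *\<^sub>R v) - pd u g (x + s *\<^sub>R u + 0 *\<^sub>R v)
      = (h - 0) * pd v (pd u g) (x + s *\<^sub>R u + t *\<^sub>R v)"
    using s by (intro MVT2[OF \<open>h > 0\<close>] has_real_derivative_pd g' mem) auto
  then obtain t where t: "0 < t" "t < h" and
    second: "pd u g (x + s *\<^sub>R u + h *\<^sub>R v) - pd u g (x + s *\<^sub>R u)
      = h * pd v (pd u g) (x + s *\<^sub>R u + t *\<^sub>R v)"
    by auto
  have "x + h *\<^sub>R v + h *\<^sub>R u = x + h *\<^sub>R u + h *\<^sub>R v" "x + h *\<^sub>R v + s *\<^sub>R u = x + s *\<^sub>R u + h *\<^sub>R v"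
    by simp_all
  with first second have
    "g (x + h *\<^sub>R u + h *\<^sub>R v) - g (x + h *\<^sub>R u) - g (x + h *\<^sub>R v) + g x
      = h * h * pd v (pd u g) (x + s *\<^sub>R u + t *\<^sub>R v)"
    by (simp add: algebra_simps)
  with s t show thesis
    by (rule that)
qed

text \<open>Both mixed derivatives, at nearby points, equal the same second difference divided by
  \<open>h * h\<close>. By continuity they cannot have different values at \<open>x\<close>.\<close>

lemma pd_commute:
  assumes "open S" "smooth_on g S" "x \<in> S"
  shows "pd u (pd v g) x = pd v (pd u g) x"
proof (rule ccontr)
  assume ne: "pd u (pd v g) x \<noteq> pd v (pd u g) x"
  \<comment> \<open>Half the gap, so that the open \<open>e\<close>-balls around the two values are
    disjoint.\<close>
  define e where "e = \<bar>pd u (pd v g) x - pd v (pd u g) x\<bar> / 2"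
  have "e > 0"
    using ne by (simp add: e_def)
  have near: "\<forall>\<^sub>F y in nhds x. dist (pd a (pd b g) y) (pd a (pd b g) x) < e" for a b
  proof -
    have "continuous_on S (pd a (pd b g))"
      by (intro smooth_on_continuous_on smooth_on_pd assms)
    then have "isCont (pd a (pd b g)) x"
      using assms continuous_on_eq_continuous_at by blast
    then have "(pd a (pd b g) \<longlongrightarrow> pd a (pd b g) x) (nhds x)"
      by (simp add: continuous_at tendsto_at_iff_tendsto_nhds)
    then show ?thesis
      using \<open>e > 0\<close> by (rule tendstoD)
  qed
  have "\<forall>\<^sub>F y in nhds x. y \<in> S \<and> dist (pd u (pd v g) y) (pd u (pd v g) x) < e
      \<and> dist (pd v (pd u g) y) (pd v (pd u g) x) < e"
    using near eventually_nhds_in_open[OF assms(1,3)] by (intro eventually_conj) auto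
  then obtain d where "d > 0" and d: "\<And>y. dist y x < d \<Longrightarrow> y \<in> S
      \<and> dist (pd u (pd v g) y) (pd u (pd v g) x) < e
      \<and> dist (pd v (pd u g) y) (pd v (pd u g) x) < e"
    unfolding eventually_nhds_metric by blast
  \<comment> \<open>The parallelogram with sides \<open>h u\<close> and \<open>h v\<close> then lies
    in the ball of radius \<open>d\<close>; the summand 1 keeps the denominator positive when
    \<open>u\<close> and \<open>v\<close> vanish.\<close>
  define h where "h = d / (2 * (norm u + norm v + 1))"
  have "h > 0"
    using \<open>d > 0\<close> unfolding h_def by (intro divide_pos_pos mult_pos_pos) (auto simp: add_nonneg_pos)
  have small: "dist (x + s *\<^sub>R u + t *\<^sub>R v) x < d" if "0 \<le> s" "s \<le> h" "0 \<le> t" "t \<le> h" for s t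
  proof -
    have "dist (x + s *\<^sub>R u + t *\<^sub>R v) x = norm (s *\<^sub>R u + t *\<^sub>R v)"
      by (simp add: dist_norm algebra_simps)
    also have "\<dots> \<le> s * norm u + t * norm v"
      using norm_triangle_ineq[of "s *\<^sub>R u" "t *\<^sub>R v"] that by simp
    also have "\<dots> \<le> h * norm u + h * norm v"
      using that by (intro add_mono mult_right_mono) auto
    also have "\<dots> \<le> h * (norm u + norm v + 1)"
      using \<open>h > 0\<close> by (simp add: algebra_simps)
    also have "\<dots> = d / 2"
      by (simp add: h_def field_simps add_nonneg_eq_0_iff)
    finally show ?thesis
      using \<open>d > 0\<close> by simp
  qed
  have diff: "g differentiable (at y)" "pd w g differentiable (at y)" if "y \<in> S" for w y
    using that assms by (auto intro: smooth_on_differentiable smooth_on_pd)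
  obtain s t where st: "0 < s" "s < h" "0 < t" "t < h" and
    uv: "g (x + h *\<^sub>R u + h *\<^sub>R v) - g (x + h *\<^sub>R u) - g (x + h *\<^sub>R v) + g x
      = h * h * pd v (pd u g) (x + s *\<^sub>R u + t *\<^sub>R v)"
    by (rule second_difference_mean_value[of h x u v S g]) (use \<open>h > 0\<close> small d diff in auto)
  have mem': "x + s *\<^sub>R v + t *\<^sub>R u \<in> S" if "0 \<le> s" "s \<le> h" "0 \<le> t" "t \<le> h" for s t
    using d[OF small[of t s]] that by (simp add: add_ac)
  obtain s' t' where st': "0 < s'" "s' < h" "0 < t'" "t' < h" and
    vu: "g (x + h *\<^sub>R v + h *\<^sub>R u) - g (x + h *\<^sub>R v) - g (x + h *\<^sub>R u) + g x
      = h * h * pd u (pd v g) (x + s' *\<^sub>R v + t' *\<^sub>R u)"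
    by (rule second_difference_mean_value[of h x v u S g]) (use \<open>h > 0\<close> mem' diff in auto)
  have swap: "x + h *\<^sub>R v + h *\<^sub>R u = x + h *\<^sub>R u + h *\<^sub>R v"
    "x + s' *\<^sub>R v + t' *\<^sub>R u = x + t' *\<^sub>R u + s' *\<^sub>R v"
    by simp_all
  have "h * h * pd v (pd u g) (x + s *\<^sub>R u + t *\<^sub>R v)
      = h * h * pd u (pd v g) (x + t' *\<^sub>R u + s' *\<^sub>R v)"
    using uv vu unfolding swap by linarith
  then have "pd v (pd u g) (x + s *\<^sub>R u + t *\<^sub>R v) = pd u (pd v g) (x + t' *\<^sub>R u + s' *\<^sub>R v)"
    using \<open>h > 0\<close> by simp
  moreover have "dist (pd v (pd u g) (x + s *\<^sub>R u + t *\<^sub>R v)) (pd v (pd u g) x) < e"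
    using d small st by simp
  moreover have "dist (pd u (pd v g) (x + t' *\<^sub>R u + s' *\<^sub>R v)) (pd u (pd v g) x) < e"
    using d small st' by simp
  ultimately show False
    by (simp add: e_def dist_real_def abs_if split: if_splits)
qed

section \<open>The total derivative and its commutators\<close>

lemma open_jet2_dom: "open U \<Longrightarrow> open I \<Longrightarrow> open (jet2_dom U I)"
  by (simp add: jet2_dom_def open_Times)

lemma snd_in_jet2_dom: "z \<in> jet3_dom U I \<Longrightarrow> snd z \<in> jet2_dom U I"
  by (auto simp: jet3_dom_def)

lemma total_deriv_eq:
  "total_deriv g z =
      pd e_t g (snd z)
    + (\<Sum>c\<in>UNIV. fst (snd (snd z)) $ c * pd (e_q c) g (snd z))
    + (\<Sum>c\<in>UNIV. fst (snd z) $ c * pd (e_qd c) g (snd z))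
    + (\<Sum>c\<in>UNIV. fst z $ c * pd (e_qdd c) g (snd z))"
  by (cases z) (simp add: total_deriv_def)

lemma total_deriv_cong:
  assumes "open U" "open I" "z \<in> jet3_dom U I"
    and "\<And>y. y \<in> jet2_dom U I \<Longrightarrow> g y = g' y"
  shows "total_deriv g z = total_deriv g' z"
proof -
  have "pd v g (snd z) = pd v g' (snd z)" for v
    using assms by (intro pd_cong[of "jet2_dom U I"] open_jet2_dom snd_in_jet2_dom)
  then show ?thesis
    by (simp add: total_deriv_eq)
qed

lemma total_deriv_zero [simp]: "total_deriv (\<lambda>_. 0) z = 0"
  by (simp add: total_deriv_eq)

lemma total_deriv_linear_combination:
  assumes "g differentiable (at (snd z))" "g' differentiable (at (snd z))"
  shows "total_deriv (\<lambda>y. \<alpha> * g y + \<beta> * g' y) z = \<alpha> * total_deriv g z + \<beta> * total_deriv g' z"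
  by (simp add: total_deriv_eq pd_linear_combination[OF assms] algebra_simps sum.distrib
      sum_distrib_left)

text \<open>The commutator of the derivative along \<open>u\<close> with the total derivative: the
  components of \<open>u\<close> along \<open>q'''\<close>, \<open>q''\<close>, \<open>q'\<close>
  act as directions \<open>q''\<close>, \<open>q'\<close>, \<open>q\<close>. Those along
  \<open>q\<close> and \<open>t\<close> drop out, as no coefficient of the total derivative depends
  on them.\<close>

definition shift_deriv :: "'n jet3 \<Rightarrow> ('n::finite jet2 \<Rightarrow> real) \<Rightarrow> 'n jet2 \<Rightarrow> real" where
  "shift_deriv u g y =
      (\<Sum>c\<in>UNIV. fst (snd (snd u)) $ c * pd (e_q c) g y)
    + (\<Sum>c\<in>UNIV. fst (snd u) $ c * pd (e_qd c) g y)
    + (\<Sum>c\<in>UNIV. fst u $ c * pd (e_qdd c) g y)"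

lemma sum_axis_mult: "(\<Sum>d\<in>UNIV. axis c (1::real) $ d * F d) = F c"
  by (simp add: axis_def if_distrib[of "\<lambda>x. x * _"] cong: if_cong)

lemma shift_deriv_basis [simp]:
  "shift_deriv (axis c 1, 0) g y = pd (e_qdd c) g y"
  "shift_deriv (0, e_qdd c) g y = pd (e_qd c) g y"
  "shift_deriv (0, e_qd c) g y = pd (e_q c) g y"
  "shift_deriv (0, e_q c) g y = 0"
  by (simp_all add: shift_deriv_def e_qdd_def e_qd_def e_q_def sum_axis_mult)

text \<open>The commutator of the total derivative with a constant direction \<open>u\<close> lowers the jet order of
  every component of \<open>u\<close> by one.\<close>

lemma has_real_derivative_total_deriv:
  fixes g :: "'n::finite jet2 \<Rightarrow> real"
  assumes U: "open U" and I: "open I" and g: "smooth_on g (jet2_dom U I)"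
    and z: "z \<in> jet3_dom U I"
  shows "((\<lambda>h. total_deriv g (z + h *\<^sub>R u)) has_real_derivative
      total_deriv (pd (snd u) g) z + shift_deriv u g (snd z)) (at 0)"
proof -
  have J: "open (jet2_dom U I)" and y: "snd z \<in> jet2_dom U I"
    using U I z by (simp_all add: open_jet2_dom snd_in_jet2_dom)
  have D: "((\<lambda>h. pd w g (snd z + h *\<^sub>R snd u)) has_real_derivative pd w (pd (snd u) g) (snd z)) (at 0)"
    for w
    using has_real_derivative_pd[of "pd w g" "snd z" 0 "snd u"] pd_commute[OF J g y, of w "snd u"]
      smooth_on_differentiable[OF smooth_on_pd[OF J g] y] by simp
  \<comment> \<open>Product rule for a coefficient that is itself a jet coordinate, moving at rate
    \<open>r\<close>; the terms with \<open>r\<close> make up \<open>shift_deriv\<close>.\<close>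
  have P: "((\<lambda>h. (p + h * r) * pd w g (snd z + h *\<^sub>R snd u)) has_real_derivative
      p * pd w (pd (snd u) g) (snd z) + r * pd w g (snd z)) (at 0)" for p r w
    by (rule derivative_eq_intros D refl)+ simp
  have "((\<lambda>h. pd e_t g (snd z + h *\<^sub>R snd u)
      + (\<Sum>c\<in>UNIV. (fst (snd (snd z)) $ c + h * fst (snd (snd u)) $ c) * pd (e_q c) g (snd z + h *\<^sub>R snd u))
      + (\<Sum>c\<in>UNIV. (fst (snd z) $ c + h * fst (snd u) $ c) * pd (e_qd c) g (snd z + h *\<^sub>R snd u))
      + (\<Sum>c\<in>UNIV. (fst z $ c + h * fst u $ c) * pd (e_qdd c) g (snd z + h *\<^sub>R snd u)))
    has_real_derivative
      pd e_t (pd (snd u) g) (snd z)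
      + (\<Sum>c\<in>UNIV. fst (snd (snd z)) $ c * pd (e_q c) (pd (snd u) g) (snd z)
          + fst (snd (snd u)) $ c * pd (e_q c) g (snd z))
      + (\<Sum>c\<in>UNIV. fst (snd z) $ c * pd (e_qd c) (pd (snd u) g) (snd z)
          + fst (snd u) $ c * pd (e_qd c) g (snd z))
      + (\<Sum>c\<in>UNIV. fst z $ c * pd (e_qdd c) (pd (snd u) g) (snd z)
          + fst u $ c * pd (e_qdd c) g (snd z))) (at 0)"
    by (intro DERIV_add DERIV_sum D P)
  then show ?thesis
    by (simp add: total_deriv_eq shift_deriv_def sum.distrib add_ac)
qed

text \<open>The common shape of \<open>r_fun\<close> (coefficients 1, -1, 1/2) and
  \<open>s_fun\<close> (1/2, 1/2, -1), so that one formula gives all their partial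
  derivatives.\<close>

lemma pd_jet2_plus_total_deriv:
  fixes A B g :: "'n::finite jet2 \<Rightarrow> real"
  assumes "open U" "open I" "z \<in> jet3_dom U I"
    and "smooth_on A (jet2_dom U I)" "smooth_on B (jet2_dom U I)" "smooth_on g (jet2_dom U I)"
    and F: "\<And>z. F z = \<alpha> * A (snd z) + \<beta> * B (snd z) + \<gamma> * total_deriv g z"
  shows "pd u F z = \<alpha> * pd (snd u) A (snd z) + \<beta> * pd (snd u) B (snd z)
    + \<gamma> * (total_deriv (pd (snd u) g) z + shift_deriv u g (snd z))"
proof -
  have D: "((\<lambda>h. C (snd (z + h *\<^sub>R u))) has_real_derivative pd (snd u) C (snd z)) (at 0)"
    if "smooth_on C (jet2_dom U I)" for C
    using has_real_derivative_pd[of C "snd z" 0 "snd u"]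
      smooth_on_differentiable[OF that snd_in_jet2_dom[OF assms(3)]] by simp
  show ?thesis
    unfolding pd_def[of u F] F
    by (intro DERIV_imp_deriv DERIV_add DERIV_cmult D assms(4,5)
        has_real_derivative_total_deriv[OF assms(1,2,6,3)])
qed

text \<open>Moving along \<open>u\<close> changes only \<open>q'''\<close> and \<open>q''\<close>,
  so \<open>F\<close> is constant on the line.\<close>

lemma pd_first_order:
  fixes F :: "'n::finite jet3 \<Rightarrow> real"
  assumes "first_order U I F" "z \<in> jet3_dom U I" "snd (snd u) = 0"
  shows "pd u F z = 0"
proof -
  obtain x3 x2 x1 q t where z: "z = (x3, x2, x1, q, t)" and "q \<in> U" "t \<in> I"
    using assms(2) by (auto simp: jet3_dom_def jet2_dom_def)
  obtain u3 u2 where u: "u = (u3, u2, 0)"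
    using assms(3) by (metis prod.collapse)
  have "F (z + h *\<^sub>R u) = F z" for h
    using assms(1) \<open>q \<in> U\<close> \<open>t \<in> I\<close> unfolding first_order_def z u by (simp add: zero_prod_def)
  then show ?thesis
    by (simp add: pd_def)
qed

section \<open>The symmetry identity for \<open>s\<close> and the cyclic identity for
  \<open>r\<close>\<close>

theorem mainTheorem2:
  fixes U :: "(real^'n::finite) set" and I :: "real set"
    and f :: "'n \<Rightarrow> 'n jet2 \<Rightarrow> real"
  assumes "open U" and "open I" and "is_interval I"
    and "\<And>a. smooth_on (f a) (jet2_dom U I)"
    and "\<And>a b. first_order U I (r_fun f a b)"
    and "\<And>a b. first_order U I (s_fun f a b)"
    and "\<And>a b y. y \<in> jet2_dom U I \<Longrightarrow> pd (e_qdd b) (f a) y = pd (e_qdd a) (f b) y"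
    and "\<And>a b c z. z \<in> jet3_dom U I \<Longrightarrow>
           pd (0, e_qd c) (r_fun f a b) z
           = pd (0, e_q b) (s_fun f a c) z - pd (0, e_q a) (s_fun f b c) z"
  shows "\<forall>a b c. \<forall>z\<in>jet3_dom U I.
           pd (0, e_qd c) (s_fun f a b) z = pd (0, e_qd b) (s_fun f a c) z \<and>
           pd (0, e_q c) (r_fun f a b) z + pd (0, e_q a) (r_fun f b c) z
             + pd (0, e_q b) (r_fun f c a) z = 0"
proof -
  note U = assms(1) and I = assms(2) and f = assms(4)
  let ?J = "jet2_dom U I" and ?Z = "jet3_dom U I"
  let ?X = "\<lambda>c. pd (e_qdd c)" and ?V = "\<lambda>c. pd (e_qd c)" and ?Q = "\<lambda>c. pd (e_q c)"
  let ?D = total_deriv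
  let ?W = "\<lambda>a b y. ?V a (f b) y - ?V b (f a) y"
  have J: "open ?J"
    using U I by (rule open_jet2_dom)
  have sm: "smooth_on (pd v (f a)) ?J" for v a
    using J f by (rule smooth_on_pd)
  have sm2: "smooth_on (pd w (pd v (f a))) ?J" for w v a
    using J sm by (rule smooth_on_pd)
  have smW: "smooth_on (?W a b) ?J" for a b
    by (intro smooth_on_diff J sm)
  note comm = pd_commute[OF J f]
  note cong = total_deriv_cong[OF U I]
  have pdW: "pd v (?W a b) y = pd v (?V a (f b)) y - pd v (?V b (f a)) y" if "y \<in> ?J" for v a b y
    using pd_linear_combination[OF sm[THEN smooth_on_differentiable, OF that]
        sm[THEN smooth_on_differentiable, OF that], of v 1 "e_qd a" b "-1" "e_qd b" a] by simp
  have D_lin: "?D (\<lambda>y. \<alpha> * g y + \<beta> * g' y) z = \<alpha> * ?D g z + \<beta> * ?D g' z"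
    if "smooth_on g ?J" "smooth_on g' ?J" "z \<in> ?Z" for \<alpha> \<beta> g g' z
    using that
    by (blast intro: total_deriv_linear_combination smooth_on_differentiable snd_in_jet2_dom)
  have pd_r: "pd u (r_fun f a b) z = pd (snd u) (?Q b (f a)) (snd z) - pd (snd u) (?Q a (f b)) (snd z)
      + 1/2 * (?D (pd (snd u) (?W a b)) z + shift_deriv u (?W a b) (snd z))"
    if "z \<in> ?Z" for u a b z
    using pd_jet2_plus_total_deriv[OF U I that sm[of "e_q b" a] sm[of "e_q a" b] smW[of a b],
        of "r_fun f a b" 1 "-1" "1/2" u]
    by (simp add: r_fun_def)
  have pd_s: "pd u (s_fun f a b) z
      = 1/2 * (pd (snd u) (?V b (f a)) (snd z) + pd (snd u) (?V a (f b)) (snd z))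
      - (?D (pd (snd u) (?X a (f b))) z + shift_deriv u (?X a (f b)) (snd z))"
    if "z \<in> ?Z" for u a b z
    using pd_jet2_plus_total_deriv[OF U I that sm[of "e_qd b" a] sm[of "e_qd a" b] sm[of "e_qdd a" b],
        of "s_fun f a b" "1/2" "1/2" "-1" u]
    by (simp add: s_fun_def algebra_simps)

  \<comment> \<open>Taking \<open>q''' = 0\<close> turns identities on \<open>jet3_dom\<close> into
    identities between functions on \<open>jet2_dom\<close>.\<close>
  have lift: "(0, y) \<in> ?Z" if "y \<in> ?J" for y
    using that by (simp add: jet3_dom_def)
  \<comment> \<open>Along \<open>q'''\<close> only the shift term of \<open>pd_r\<close> survives,
    and it is half of \<open>X\<^sub>c W\<^sub>a\<^sub>b\<close>.\<close>
  have XW: "?X c (?W a b) y = 0" if "y \<in> ?J" for a b c y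
    using pd_first_order[OF assms(5) lift[OF that], of "(axis c 1, 0)" a b]
      pd_r[OF lift[OF that], of "(axis c 1, 0)" a b] by simp
  then have XV: "?X c (?V a (f b)) y = ?X c (?V b (f a)) y" if "y \<in> ?J" for a b c y
    using pdW[OF that, of "e_qdd c" a b] that by simp
  have VW: "?V c (?W a b) y = 2 * ?Q a (?X c (f b)) y + (- 2) * ?Q b (?X c (f a)) y"
    if "y \<in> ?J" for a b c y
  proof -
    have "?D (?X c (?W a b)) (0, y) = ?D (\<lambda>_. 0) (0, y)"
      by (rule cong[OF lift[OF that]]) (rule XW)
    moreover have "pd (0, e_qdd c) (r_fun f a b) (0, y) = 0"
      using assms(5) lift[OF that] by (rule pd_first_order) (simp add: e_qdd_def zero_prod_def)
    ultimately show ?thesis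
      using pd_r[OF lift[OF that], of "(0, e_qdd c)" a b]
        comm[OF that, of "e_qdd c" "e_q a" b] comm[OF that, of "e_qdd c" "e_q b" a] by simp
  qed

  have s_sym: "pd (0, e_qd c) (s_fun f a b) z = pd (0, e_qd b) (s_fun f a c) z"
    if z: "z \<in> ?Z" for a b c z
  proof -
    have y: "snd z \<in> ?J"
      using z by (rule snd_in_jet2_dom)
    \<comment> \<open>The terms under \<open>D\<close> agree: \<open>V\<^sub>c X\<^sub>a f\<^sub>b =
      X\<^sub>a V\<^sub>c f\<^sub>b = X\<^sub>a V\<^sub>b f\<^sub>c = V\<^sub>b X\<^sub>a
      f\<^sub>c\<close>.\<close>
    have "?D (?V c (?X a (f b))) z = ?D (?V b (?X a (f c))) z"
    proof (rule cong[OF z])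
      fix y assume y: "y \<in> ?J"
      show "?V c (?X a (f b)) y = ?V b (?X a (f c)) y"
        using comm[OF y, of "e_qd c" "e_qdd a" b] comm[OF y, of "e_qd b" "e_qdd a" c]
          XV[OF y, of a c b] by simp
    qed
    \<comment> \<open>This is \<open>V\<^sub>a W\<^sub>b\<^sub>c\<close>; it makes the second-order
      \<open>V\<close>-terms cancel the shift terms of the two derivatives of
      \<open>s\<close>.\<close>
    moreover have "?V a (?V b (f c)) (snd z) - ?V a (?V c (f b)) (snd z)
        = 2 * ?Q b (?X a (f c)) (snd z) - 2 * ?Q c (?X a (f b)) (snd z)"
      using VW[OF y, of a b c] pdW[OF y, of "e_qd a" b c] by simp
    ultimately show ?thesis
      using pd_s[OF z, of "(0, e_qd c)" a b] pd_s[OF z, of "(0, e_qd b)" a c]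
        comm[OF y, of "e_qd c" "e_qd b" a] comm[OF y, of "e_qd c" "e_qd a" b]
        comm[OF y, of "e_qd b" "e_qd a" c]
      by (simp add: algebra_simps)
  qed

  have QW: "?Q c (?W a b) y + ?Q a (?W b c) y + ?Q b (?W c a) y = 0" if y: "y \<in> ?J" for a b c y
  proof -
    let ?z = "(0, y)"
    note z = lift[OF y]
    \<comment> \<open>The symmetry of \<open>X\<^sub>a f\<^sub>c\<close> in its indices,
      differentiated along \<open>q\<close>, rewrites the \<open>D\<close>-terms with
      \<open>f\<^sub>c\<close>, as they occur in \<open>s\<^sub>a\<^sub>c\<close> and
      \<open>s\<^sub>b\<^sub>c\<close>.\<close>
    have XQ: "?D (?Q b (?X a (f c))) ?z = ?D (?Q b (?X c (f a))) ?z" for a b c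
      by (rule cong[OF z], rule pd_cong[OF J]) (auto intro: assms(7))
    have "?D (?V c (?W a b)) ?z
        = ?D (\<lambda>y. 2 * ?Q a (?X c (f b)) y + (- 2) * ?Q b (?X c (f a)) y) ?z"
      by (rule cong[OF z]) (rule VW)
    also have "\<dots> = 2 * ?D (?Q a (?X c (f b))) ?z + (- 2) * ?D (?Q b (?X c (f a))) ?z"
      by (rule D_lin[OF sm2 sm2 z])
    finally have DVW: "?D (?V c (?W a b)) ?z
        = 2 * ?D (?Q a (?X b (f c))) ?z - 2 * ?D (?Q b (?X a (f c))) ?z"
      using XQ[of a c b] XQ[of b c a] by simp
    \<comment> \<open>By \<open>DVW\<close> the \<open>D\<close>-terms on the two sides of the
      hypothesis coincide; what is left is half the cyclic sum.\<close>
    show ?thesis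
      using assms(8)[OF z, of c a b] pd_r[OF z, of "(0, e_qd c)" a b]
        pd_s[OF z, of "(0, e_q b)" a c] pd_s[OF z, of "(0, e_q a)" b c] DVW
        comm[OF y, of "e_qd c" "e_q b" a] comm[OF y, of "e_qd c" "e_q a" b]
      by (simp add: pdW[OF y] algebra_simps)
  qed

  have "pd (0, e_q c) (r_fun f a b) z + pd (0, e_q a) (r_fun f b c) z
      + pd (0, e_q b) (r_fun f c a) z = 0" if z: "z \<in> ?Z" for a b c z
  proof -
    have y: "snd z \<in> ?J"
      using z by (rule snd_in_jet2_dom)
    have smQ: "smooth_on (?Q c (?W a b)) ?J" for a b c
      using J smW by (rule smooth_on_pd)
    \<comment> \<open>\<open>QW\<close> holds on the whole open domain and so may be differentiated
      by \<open>D\<close>.\<close>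
    have "?D (?Q c (?W a b)) z = ?D (\<lambda>y. (- 1) * ?Q a (?W b c) y + (- 1) * ?Q b (?W c a) y) z"
    proof (rule cong[OF z])
      fix y assume "y \<in> ?J"
      from QW[OF this, of c a b]
      show "?Q c (?W a b) y = (- 1) * ?Q a (?W b c) y + (- 1) * ?Q b (?W c a) y"
        by linarith
    qed
    also have "\<dots> = (- 1) * ?D (?Q a (?W b c)) z + (- 1) * ?D (?Q b (?W c a)) z"
      by (rule D_lin[OF smQ smQ z])
    \<comment> \<open>Directions along \<open>q\<close> have no shift term, and the terms
      \<open>Q\<^sub>c Q\<^sub>b f\<^sub>a\<close> cancel in pairs over the cyclic sum.\<close>
    finally show ?thesis
      using pd_r[OF z, of "(0, e_q c)" a b] pd_r[OF z, of "(0, e_q a)" b c]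
        pd_r[OF z, of "(0, e_q b)" c a]
        comm[OF y, of "e_q c" "e_q b" a] comm[OF y, of "e_q c" "e_q a" b]
        comm[OF y, of "e_q a" "e_q b" c]
      by (simp add: field_simps)
  qed
  with s_sym show ?thesis
    by blast
qed

end
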